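(* If $G$ and $H$ are graphs, then $$\mathrm{sg}(G \,\square\, H) \leq \min\{ \mathrm{sgc}(H)(n(G)-1) + \mathrm{sg}(H),\ \mathrm{sgc}(G)(n(H)-1) +\mathrm{sg}(G) \}.$$
   Context: Graphs are finite and simple; strong geodetic notions are considered for connected graphs. $G\,\square\,H$ is the Cartesian product: vertex set $V(G)\times V(H)$, with $(g,h)\sim(g',h')$ iff either $g=g'$ and $hh'\in E(H)$, or $h=h'$ and $gg'\in E(G)$. $n(G)$ is the order of $G$. For a graph $G$ and $S\subseteq V(G)$, one fixes for each unordered pair $\{x,y\}$ of distinct vertices of $S$ a single shortest $x,y$-path $\widetilde g(x,y)$; $S$ is a strong geodetic set if for some such choice the union of the vertex sets of the chosen paths equals $V(G)$ (for a one-vertex graph, that vertex forms a strong geodetic set). $\mathrm{sg}(G)$ is the minimum size of a strong geodetic set; a minimum one is an sg-set. For a strong geodetic set $S$, a set $X\subseteq S$ is a strong geodetic core for $S$ if there exists a choice of fixed shortest paths $\widetilde g(x,y)$ for pairs of $S$ such that $\bigcup_{(u,v)\in X\times S} V(\widetilde g(u,v)) = V(G)$. $\mathrm{sgc}(S)$ is the minimum size of a strong geodetic core for $S$, and $\mathrm{sgc}(G)=\min\{\mathrm{sgc}(S): S \text{ an sg-set of } G\}$. *)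

theory Defs
  imports "Graph_Theory.Graph_Theory"
begin

text \<open>
  A finite simple graph is a \<open>pair_graph\<close>: a finite, loop-free, symmetric set of arcs. An edge
  \<open>uv\<close> is the pair of arcs \<open>(u,v)\<close>, \<open>(v,u)\<close>. Note that \<open>connected\<close> excludes the null graph.
\<close>

definition order :: "'a pair_pre_digraph \<Rightarrow> nat" where
  "order G = card (pverts G)"

definition cartesian_product ::
  "'a pair_pre_digraph \<Rightarrow> 'b pair_pre_digraph \<Rightarrow> ('a \<times> 'b) pair_pre_digraph"
  (infixl \<open>\<box>\<close> 70) where
  "G \<box> H = \<lparr> pverts = pverts G \<times> pverts H,
             parcs = {((g, h), (g', h')) | g h g' h'.
                 (g = g' \<and> g \<in> pverts G \<and> (h, h') \<in> parcs H) \<or>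
                 (h = h' \<and> h \<in> pverts H \<and> (g, g') \<in> parcs G)} \<rparr>"

definition path_between :: "'a pair_pre_digraph \<Rightarrow> 'a \<Rightarrow> 'a list \<Rightarrow> 'a \<Rightarrow> bool" where
  "path_between G x p y \<longleftrightarrow> vpath p (with_proj G) \<and> hd p = x \<and> last p = y"

definition shortest_path :: "'a pair_pre_digraph \<Rightarrow> 'a \<Rightarrow> 'a list \<Rightarrow> 'a \<Rightarrow> bool" where
  "shortest_path G x p y \<longleftrightarrow>
     path_between G x p y \<and> (\<forall>q. path_between G x q y \<longrightarrow> vwalk_length p \<le> vwalk_length q)"

text \<open>
  A choice of one shortest path per unordered pair of vertices of \<open>S\<close>: \<open>g x y\<close> and \<open>g y x\<close> are
  the same path, traversed in opposite directions. On the diagonal the condition forces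
  \<open>g x x = [x]\<close>.
\<close>

definition fixed_shortest_paths ::
  "'a pair_pre_digraph \<Rightarrow> 'a set \<Rightarrow> ('a \<Rightarrow> 'a \<Rightarrow> 'a list) \<Rightarrow> bool" where
  "fixed_shortest_paths G S g \<longleftrightarrow>
     (\<forall>x\<in>S. \<forall>y\<in>S. shortest_path G x (g x y) y \<and> g y x = rev (g x y))"

text \<open>
  The second disjunct is the convention for the one-vertex graph, which has no pair of distinct
  vertices.
\<close>

definition strong_geodetic_set :: "'a pair_pre_digraph \<Rightarrow> 'a set \<Rightarrow> bool" where
  "strong_geodetic_set G S \<longleftrightarrow> S \<subseteq> pverts G \<and>
     ((\<exists>g. fixed_shortest_paths G S g \<and>
           (\<Union>(x, y) \<in> {(x, y). x \<in> S \<and> y \<in> S \<and> x \<noteq> y}. set (g x y)) = pverts G) \<or>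
      (\<exists>v. pverts G = {v} \<and> S = {v}))"

definition sg :: "'a pair_pre_digraph \<Rightarrow> nat" where
  "sg G = (LEAST k. \<exists>S. strong_geodetic_set G S \<and> card S = k)"

definition sg_set :: "'a pair_pre_digraph \<Rightarrow> 'a set \<Rightarrow> bool" where
  "sg_set G S \<longleftrightarrow> strong_geodetic_set G S \<and> card S = sg G"

text \<open>
  The choice \<open>g\<close> may differ from one witnessing that \<open>S\<close> is strong geodetic. Pairs \<open>(u,u)\<close> occur
  in \<open>X \<times> S\<close> and contribute just \<open>u\<close>, so for the one-vertex graph \<open>X = S\<close> is a core and \<open>{}\<close> is not.
\<close>

definition strong_geodetic_core :: "'a pair_pre_digraph \<Rightarrow> 'a set \<Rightarrow> 'a set \<Rightarrow> bool" where
  "strong_geodetic_core G S X \<longleftrightarrow> X \<subseteq> S \<and>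
     (\<exists>g. fixed_shortest_paths G S g \<and> (\<Union>(u, v) \<in> X \<times> S. set (g u v)) = pverts G)"

definition sgc_of :: "'a pair_pre_digraph \<Rightarrow> 'a set \<Rightarrow> nat" where
  "sgc_of G S = (LEAST k. \<exists>X. strong_geodetic_core G S X \<and> card X = k)"

definition sgc :: "'a pair_pre_digraph \<Rightarrow> nat" where
  "sgc G = (LEAST k. \<exists>S. sg_set G S \<and> sgc_of G S = k)"

end

theory Submission
  imports Defs
begin

text \<open>
  Fix a vertex \<open>g0\<close> of \<open>G\<close>, an sg-set \<open>S\<close> of \<open>H\<close> and a core \<open>X\<close> for \<open>S\<close>. The set
  \<open>{g0} \<times> S \<union> (V(G) - {g0}) \<times> X\<close> is strong geodetic in \<open>G \<box> H\<close>: inside the layer \<open>{g} \<times> V(H)\<close>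
  the core paths from \<open>(g, x)\<close> to \<open>(g, s)\<close> cover everything, and when \<open>(g, s)\<close> is not in the set
  such a path is prolonged to \<open>(g0, s)\<close> along \<open>G\<close>. The result is shortest because distances in the
  product add up. The other half of the minimum follows by swapping the factors.
\<close>

section \<open>Shortest paths\<close>

lemma path_between_iff:
  "path_between G x p y \<longleftrightarrow> p \<noteq> [] \<and> set p \<subseteq> pverts G \<and> set (vwalk_arcs p) \<subseteq> parcs G \<and>
     distinct p \<and> hd p = x \<and> last p = y"
  by (auto simp: path_between_def vpath_def vwalk_def)

lemma path_between_self_iff: "path_between G x p x \<longleftrightarrow> x \<in> pverts G \<and> p = [x]"
  by (cases p) (auto simp: path_between_iff split: if_splits)

lemma path_between_start_in_set: "path_between G x p y \<Longrightarrow> x \<in> set p"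
  by (auto simp: path_between_iff)

lemma path_between_rev:
  assumes "sym (parcs G)" "path_between G x p y"
  shows "path_between G y (rev p) x"
  using assms by (auto simp: path_between_iff hd_rev last_rev set_vwalk_arcs_rev sym_def)

text \<open>Reversal also turns every competitor from y to x into one from x to y of the same
  length, so minimality carries over.\<close>

lemma shortest_path_rev:
  assumes "sym (parcs G)" "shortest_path G x p y"
  shows "shortest_path G y (rev p) x"
  using assms path_between_rev[OF assms(1)] unfolding shortest_path_def
  by (metis length_rev vwalk_length_simp)

lemma shortest_path_self: "shortest_path G x p x \<Longrightarrow> p = [x]"
  by (simp add: shortest_path_def path_between_self_iff)

text \<open>Minimality is defined against paths only, but projecting a path of the product to a
  factor gives just a walk. Cutting loops with \<open>vwalk_to_vpath\<close> keeps the ends and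
  never lengthens the list.\<close>

lemma shortest_path_le_vwalk:
  assumes "shortest_path G x p y" "vwalk q (with_proj G)" "hd q = x" "last q = y"
  shows "length p \<le> length q"
proof -
  have len: "length (vwalk_to_vpath q) \<le> length q" for q :: "'a list"
    by (induct q rule: vwalk_to_vpath_induct3)
      (auto intro: le_trans[OF _ le_SucI] length_dropWhile_le le_trans[OF _ length_dropWhile_le])
  have "path_between G x (vwalk_to_vpath q) y"
    using assms(2-) by (simp add: path_between_def vwalk_to_vpath_vpath vwalk_to_vpath_hd vwalk_to_vpath_last)
  \<comment> \<open>Nonemptiness turns the comparison of arc counts, a truncated
    \<open>length - 1\<close>, into one of vertex counts.\<close>
  moreover have "vwalk_to_vpath q \<noteq> []" "p \<noteq> []"
    using calculation assms(1) by (auto simp: path_between_iff shortest_path_def)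
  ultimately have "length p \<le> length (vwalk_to_vpath q)"
    using assms(1) by (auto simp: shortest_path_def Suc_le_eq dest!: spec[of _ "vwalk_to_vpath q"])
      (metis Suc_pred diff_le_mono length_greater_0_conv not_less_eq_eq)
  then show ?thesis using len[of q] by simp
qed

lemma ex_shortest_path:
  assumes "path_between G x p y"
  shows "\<exists>q. shortest_path G x q y"
  using ex_has_least_nat[of "\<lambda>q. path_between G x q y", OF assms, of vwalk_length]
  unfolding shortest_path_def by blast

lemma connected_ex_shortest_path:
  assumes "pair_graph G" "Digraph_Component.connected (with_proj G)"
    and "x \<in> pverts G" "y \<in> pverts G"
  shows "\<exists>p. shortest_path G x p y"
proof -
  interpret pair_graph G by fact
  have "x \<rightarrow>\<^sup>*\<^bsub>with_proj G\<^esub> y"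
    using symmetric_connected_imp_strongly_connected[OF pair_sym_arcs assms(2)] assms(3,4)
    by (simp add: strongly_connected_def)
  then obtain p where "vpath p (with_proj G)" "hd p = x" "last p = y"
    using reachable_vpath_conv by blast
  then show ?thesis using ex_shortest_path[of G x p y] by (simp add: path_between_def)
qed

lemma connected_pverts_nonempty:
  "Digraph_Component.connected (with_proj G) \<Longrightarrow> pverts G \<noteq> {}"
  by (auto simp: Digraph_Component.connected_def strongly_connected_def)

lemma pair_graph_sym: "pair_graph G \<Longrightarrow> sym (parcs G)"
  using pair_sym_digraph.pair_sym_arcs[of G]
  by (auto simp: pair_graph_def pair_pseudo_graph_def symmetric_def)

text \<open>An injective numbering \<open>k\<close> of S decides which orientation of a pair is
  chosen freely; the other one is its reversal. On the diagonal both coincide, hence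
  \<open>self\<close>. The predicate P is abstract so that covering conditions can be imposed along
  with minimality.\<close>

lemma symmetric_path_choice:
  assumes "finite S"
    and ex: "\<And>x y. x \<in> S \<Longrightarrow> y \<in> S \<Longrightarrow> \<exists>p. P x y p"
    and rev: "\<And>x y p. P x y p \<Longrightarrow> P y x (rev p)"
    and self: "\<And>x p. P x x p \<Longrightarrow> rev p = p"
  shows "\<exists>f. \<forall>x\<in>S. \<forall>y\<in>S. P x y (f x y) \<and> f y x = rev (f x y)"
proof -
  obtain k :: "'a \<Rightarrow> nat" where k: "inj_on k S"
    using finite_imp_inj_to_nat_seg[OF \<open>finite S\<close>] by blast
  obtain F where F: "\<And>x y. x \<in> S \<Longrightarrow> y \<in> S \<Longrightarrow> P x y (F x y)"
    using ex by metis
  define f where "f x y = (if k x \<le> k y then F x y else rev (F y x))" for x y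
  have "P x y (f x y) \<and> f y x = rev (f x y)" if "x \<in> S" "y \<in> S" for x y
  proof (cases "x = y")
    case True
    then show ?thesis using that F self[of y "F y y"] by (simp add: f_def)
  next
    case False
    then have "k x \<noteq> k y" using k that by (auto dest: inj_onD)
    then show ?thesis using that F rev by (auto simp: f_def)
  qed
  then show ?thesis by blast
qed

lemma fixed_shortest_pathsD:
  assumes "fixed_shortest_paths G S f" "x \<in> S" "y \<in> S"
  shows "shortest_path G x (f x y) y" "path_between G x (f x y) y" "f y x = rev (f x y)"
  using assms unfolding fixed_shortest_paths_def shortest_path_def by blast+

section \<open>Existence of minimum sets and cores\<close>

text \<open>This makes the \<open>LEAST\<close> in \<open>sg\<close> attained. As soon as there are
  two vertices, each vertex is covered as an end of a path to another one.\<close>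

lemma strong_geodetic_set_pverts:
  assumes "pair_graph G" "Digraph_Component.connected (with_proj G)"
  shows "strong_geodetic_set G (pverts G)"
proof -
  interpret pair_graph G by fact
  have "\<exists>f. \<forall>x\<in>pverts G. \<forall>y\<in>pverts G. shortest_path G x (f x y) y \<and> f y x = rev (f x y)"
  proof (rule symmetric_path_choice[OF pair_finite_verts])
    show "shortest_path G y (rev p) x" if "shortest_path G x p y" for x y p
      using shortest_path_rev[OF pair_graph_sym[OF assms(1)] that] .
    show "rev p = p" if "shortest_path G x p x" for x p
      using shortest_path_self[OF that] by simp
  qed (rule connected_ex_shortest_path[OF assms])
  then obtain f where f: "fixed_shortest_paths G (pverts G) f"
    unfolding fixed_shortest_paths_def by blast
  show ?thesis
  proof (cases "\<exists>v. pverts G = {v}")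
    case True
    then show ?thesis by (auto simp: strong_geodetic_set_def)
  next
    case False
    have path: "path_between G x (f x y) y" if "x \<in> pverts G" "y \<in> pverts G" for x y
      using fixed_shortest_pathsD(2)[OF f that] .
    have "(\<Union>(x, y) \<in> {(x, y). x \<in> pverts G \<and> y \<in> pverts G \<and> x \<noteq> y}. set (f x y)) = pverts G"
    proof (intro equalityI subsetI)
      fix v assume v: "v \<in> pverts G"
      then obtain w where "w \<in> pverts G" "v \<noteq> w" using False by blast
      then show "v \<in> (\<Union>(x, y) \<in> {(x, y). x \<in> pverts G \<and> y \<in> pverts G \<and> x \<noteq> y}. set (f x y))"
        using v path_between_start_in_set[OF path[of v w]] by blast
    qed (use path in \<open>auto simp: path_between_iff\<close>)
    then show ?thesis using f by (auto simp: strong_geodetic_set_def)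
  qed
qed

lemma strong_geodetic_core_self:
  assumes "strong_geodetic_set G S"
  shows "strong_geodetic_core G S S"
  using assms unfolding strong_geodetic_set_def
proof (elim conjE disjE exE)
  fix f assume S: "S \<subseteq> pverts G" and f: "fixed_shortest_paths G S f"
    and cover: "(\<Union>(x, y) \<in> {(x, y). x \<in> S \<and> y \<in> S \<and> x \<noteq> y}. set (f x y)) = pverts G"
  have "(\<Union>(u, v) \<in> S \<times> S. set (f u v)) = pverts G"
  proof
    have "set (f u v) \<subseteq> pverts G" if "u \<in> S" "v \<in> S" for u v
      using fixed_shortest_pathsD(2)[OF f that] by (simp add: path_between_iff)
    then show "(\<Union>(u, v) \<in> S \<times> S. set (f u v)) \<subseteq> pverts G" by blast
  qed (use cover in blast)
  then show ?thesis using f by (auto simp: strong_geodetic_core_def)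
next
  fix v assume "pverts G = {v}" "S = {v}"
  moreover from this have "fixed_shortest_paths G S (\<lambda>_ _. [v])"
    by (simp add: fixed_shortest_paths_def shortest_path_def path_between_self_iff)
  ultimately show ?thesis
    unfolding strong_geodetic_core_def by (intro conjI exI[of _ "\<lambda>_ _. [v]"]) auto
qed

text \<open>Each of the three nested minima is attained because a candidate exists: all vertices for
  \<open>sg\<close>, an sg-set for \<open>sgc\<close>, and the sg-set itself for
  \<open>sgc_of\<close>.\<close>

lemma ex_minimum_core:
  assumes "pair_graph G" "Digraph_Component.connected (with_proj G)"
  obtains S X where "sg_set G S" "strong_geodetic_core G S X" "card X = sgc G"
proof -
  have "\<exists>S. sg_set G S"
    unfolding sg_set_def sg_def
    by (rule LeastI_ex) (use strong_geodetic_set_pverts[OF assms] in blast)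
  then obtain S where S: "sg_set G S" "sgc_of G S = sgc G"
    using LeastI_ex[of "\<lambda>k. \<exists>S. sg_set G S \<and> sgc_of G S = k"] unfolding sgc_def by blast
  have "\<exists>X. strong_geodetic_core G S X \<and> card X = sgc_of G S"
    unfolding sgc_of_def
    by (rule LeastI_ex) (use S strong_geodetic_core_self sg_set_def in blast)
  then show ?thesis using S that by metis
qed

lemma sg_le_card: "strong_geodetic_set G S \<Longrightarrow> sg G \<le> card S"
  unfolding sg_def by (rule Least_le) blast

section \<open>Shortest paths in Cartesian products\<close>

lemma pverts_cartesian_product [simp]: "pverts (G \<box> H) = pverts G \<times> pverts H"
  by (simp add: cartesian_product_def)

lemma parcs_cartesian_product_iff [simp]:
  "((g, h), (g', h')) \<in> parcs (G \<box> H) \<longleftrightarrow>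
     (g = g' \<and> g \<in> pverts G \<and> (h, h') \<in> parcs H) \<or> (h = h' \<and> h \<in> pverts H \<and> (g, g') \<in> parcs G)"
  by (simp add: cartesian_product_def)

lemma sym_cartesian_product:
  assumes "sym (parcs G)" "sym (parcs H)"
  shows "sym (parcs (G \<box> H))"
  using assms by (auto simp: sym_def)

lemma vwalk_arcs_map: "vwalk_arcs (map f p) = map (map_prod f f) (vwalk_arcs p)"
  by (induct p rule: vwalk_arcs.induct) auto

text \<open>Each arc of the product uses an arc of one factor and keeps the other coordinate, so it
  extends just one of q and r. The \<open>Suc\<close> appears because lists count vertices while
  arcs are what add up.\<close>

lemma vwalk_cartesian_product_projections:
  assumes "vwalk p (with_proj (G \<box> H))"
  shows "\<exists>q r. vwalk q (with_proj G) \<and> hd q = fst (hd p) \<and> last q = fst (last p) \<and>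
    vwalk r (with_proj H) \<and> hd r = snd (hd p) \<and> last r = snd (last p) \<and>
    length q + length r = Suc (length p)"
  using assms
proof (induct p rule: list.induct)
  case Nil
  then show ?case by (simp add: vwalk_def)
next
  case (Cons a p)
  obtain g h where a: "a = (g, h)" by fastforce
  show ?case
  proof (cases "p = []")
    case True
    then show ?thesis using Cons.prems a by (auto intro!: exI[of _ "[g]"] exI[of _ "[h]"])
  next
    case False
    obtain g' h' where hd: "hd p = (g', h')" by fastforce
    have arc: "(a, hd p) \<in> parcs (G \<box> H)" and p: "vwalk p (with_proj (G \<box> H))"
      and mem: "g \<in> pverts G" "h \<in> pverts H"
      using Cons.prems False a by (auto simp: vwalk_def)
    obtain q r where qr: "vwalk q (with_proj G)" "hd q = g'" "last q = fst (last p)"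
      "vwalk r (with_proj H)" "hd r = h'" "last r = snd (last p)"
      "length q + length r = Suc (length p)"
      using Cons.hyps[OF p] hd by auto
    from qr have ne: "q \<noteq> []" "r \<noteq> []" by auto
    from arc a hd consider "g = g'" "(h, h') \<in> parcs H" | "h = h'" "(g, g') \<in> parcs G" by auto
    then show ?thesis
    proof cases
      case 1
      then show ?thesis using qr ne mem a False
        by (intro exI[of _ q] exI[of _ "h # r"]) (auto intro: vwalk_consI)
    next
      case 2
      then show ?thesis using qr ne mem a False
        by (intro exI[of _ "g # q"] exI[of _ r]) (auto intro: vwalk_consI)
    qed
  qed
qed

text \<open>This is the lower bound in the additivity of distances, obtained by projecting an
  arbitrary competitor to both factors.\<close>

lemma path_cartesian_product_length_ge:
  assumes "shortest_path G g p g'" "shortest_path H h q h'"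
    and "path_between (G \<box> H) (g, h) r (g', h')"
  shows "length p + length q \<le> Suc (length r)"
proof -
  have "vwalk r (with_proj (G \<box> H))" "hd r = (g, h)" "last r = (g', h')"
    using assms(3) by (auto simp: path_between_def)
  then obtain p' q' where "vwalk p' (with_proj G)" "hd p' = g" "last p' = g'"
    and "vwalk q' (with_proj H)" "hd q' = h" "last q' = h'"
    and len: "length p' + length q' = Suc (length r)"
    using vwalk_cartesian_product_projections[of r G H] by auto
  then have "length p \<le> length p'" "length q \<le> length q'"
    using shortest_path_le_vwalk[OF assms(1)] shortest_path_le_vwalk[OF assms(2)] by blast+
  then show ?thesis using len by linarith
qed

lemma path_between_layer:
  assumes "path_between H h q h'" "g \<in> pverts G"
  shows "path_between (G \<box> H) (g, h) (map (Pair g) q) (g, h')"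
  using assms
  by (auto simp: path_between_iff hd_map last_map vwalk_arcs_map distinct_map inj_on_def)

lemma path_between_layer':
  assumes "path_between G g p g'" "h \<in> pverts H"
  shows "path_between (G \<box> H) (g, h) (map (\<lambda>v. (v, h)) p) (g', h)"
  using assms
  by (auto simp: path_between_iff hd_map last_map vwalk_arcs_map distinct_map inj_on_def)

text \<open>The join drops the head of q, which is y and the only vertex the two paths may share, so
  no vertex is repeated.\<close>

lemma path_between_join:
  assumes "path_between G x p y" "path_between G y q z" "set p \<inter> set q \<subseteq> {y}"
  shows "path_between G x (p \<oplus> q) z"
proof -
  have ne: "p \<noteq> []" "q \<noteq> []" using assms by (auto simp: path_between_iff)
  then have "joinable p q" using assms by (auto simp: path_between_iff)
  moreover have "distinct (p \<oplus> q)"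
    using assms ne by (cases q) (auto simp: path_between_iff vwalk_join_def)
  ultimately show ?thesis using assms
    by (auto simp: path_between_def vpath_def vwalk_join_hd vwalk_join_last intro: vwalk_joinI_vwalk)
qed

text \<open>Walking along H first places the whole copy of q in the starting layer; the G-part then
  meets it only in \<open>(g, h')\<close>.\<close>

lemma shortest_path_cartesian_product:
  assumes p: "shortest_path G g p g'" and q: "shortest_path H h q h'"
  shows "shortest_path (G \<box> H) (g, h) (map (Pair g) q \<oplus> map (\<lambda>v. (v, h')) p) (g', h')"
proof -
  have pq: "path_between G g p g'" "path_between H h q h'"
    using p q by (auto simp: shortest_path_def)
  then have mem: "g \<in> pverts G" "h' \<in> pverts H"
    and ne: "p \<noteq> []" "q \<noteq> []"
    by (auto simp: path_between_iff)
  have "path_between (G \<box> H) (g, h) (map (Pair g) q \<oplus> map (\<lambda>v. (v, h')) p) (g', h')"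
    by (rule path_between_join[OF path_between_layer[OF pq(2) mem(1)] path_between_layer'[OF pq(1) mem(2)]])
      auto
  \<comment> \<open>One unit is lost to the shared vertex and one to counting arcs instead of
    vertices, so the lower bound is met exactly.\<close>
  moreover have "vwalk_length (map (Pair g) q \<oplus> map (\<lambda>v. (v, h')) p) = length p + length q - 2"
    using ne by (cases p; cases q) (auto simp: vwalk_join_def)
  ultimately show ?thesis
    using path_cartesian_product_length_ge[OF p q] by (fastforce simp: shortest_path_def)
qed

lemma ex_shortest_path_through_layer:
  assumes G: "pair_graph G" "Digraph_Component.connected (with_proj G)"
    and "g \<in> pverts G" "g' \<in> pverts G" and q: "shortest_path H h q h'"
  shows "\<exists>r. shortest_path (G \<box> H) (g, h) r (g', h') \<and> {g} \<times> set q \<subseteq> set r"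
proof -
  obtain p where "shortest_path G g p g'" using connected_ex_shortest_path[OF assms(1-4)] by blast
  from shortest_path_cartesian_product[OF this q] show ?thesis
    by (auto simp: vwalk_join_def)
qed

section \<open>The strong geodetic set in the product\<close>

text \<open>The danger is that one pair, having a single fixed path, is asked to cover two layers.
  This cannot happen: a pair joining another layer to layer \<open>g0\<close> serves only that other
  layer, and layer \<open>g0\<close> is covered by pairs inside it.\<close>

lemma strong_geodetic_set_cartesian_product:
  assumes G: "pair_graph G" "Digraph_Component.connected (with_proj G)"
    and H: "pair_graph H" "pverts H \<noteq> {}"
    and S: "S \<subseteq> pverts H" and core: "strong_geodetic_core H S X" and g0: "g0 \<in> pverts G"
  shows "strong_geodetic_set (G \<box> H) ({g0} \<times> S \<union> (pverts G - {g0}) \<times> X)"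
    (is "strong_geodetic_set _ ?T")
proof -
  interpret G: pair_graph G by fact
  interpret H: pair_graph H by fact
  note symG = pair_graph_sym[OF G(1)] and symH = pair_graph_sym[OF H(1)]
  obtain k where X: "X \<subseteq> S" and k: "fixed_shortest_paths H S k"
    and cover: "(\<Union>(u, v) \<in> X \<times> S. set (k u v)) = pverts H"
    using core by (auto simp: strong_geodetic_core_def)
  from cover H(2) have "X \<noteq> {}" by auto
  have T: "?T \<subseteq> pverts (G \<box> H)" using g0 S X by auto
  have finT: "finite ?T"
    using finite_subset[OF T] G.pair_finite_verts H.pair_finite_verts by simp
  have kS: "shortest_path H s (k s t) t" "k t s = rev (k s t)" if "s \<in> S" "t \<in> S" for s t
    using fixed_shortest_pathsD(1,3)[OF k that] .
  \<comment> \<open>At most one \<open>c\<close> meets the premise: for \<open>fst a \<noteq> fst b\<close> it is the coordinate other than \<open>g0\<close>.\<close>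
  define P where "P a b r \<longleftrightarrow> a \<in> ?T \<and> b \<in> ?T \<and> shortest_path (G \<box> H) a r b \<and>
      (\<forall>c \<in> {fst a, fst b}. {fst a, fst b} \<subseteq> {c, g0} \<longrightarrow> {c} \<times> set (k (snd a) (snd b)) \<subseteq> set r)"
    for a b r
  have snd: "snd a \<in> S" if "a \<in> ?T" for a using that X by auto
  \<comment> \<open>Neither the condition on c nor the vertex set of a path of \<open>k\<close>
    depends on the orientation.\<close>
  have P_rev: "P b a (rev r)" if "P a b r" for a b r
  proof -
    have ab: "a \<in> ?T" "b \<in> ?T" and r: "shortest_path (G \<box> H) a r b"
      using that by (simp_all add: P_def)
    have "set (k (snd b) (snd a)) = set (k (snd a) (snd b))"
      using kS(2)[OF snd[OF ab(1)] snd[OF ab(2)]] by simp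
    moreover have "shortest_path (G \<box> H) b (rev r) a"
      using shortest_path_rev[OF sym_cartesian_product[OF symG symH] r] .
    ultimately show ?thesis
      using that unfolding P_def by (simp only: set_rev insert_commute[of "fst b"] simp_thms) (elim conjE)
  qed
  \<comment> \<open>The path constructed here covers the layer of its start a. The guard ensures
    that P demands no other layer; when it fails, a lies in layer \<open>g0\<close> and b outside,
    and the path from b to a is reversed instead.\<close>
  have P_ex: "\<exists>r. P a b r" if ab: "a \<in> ?T" "b \<in> ?T" and or: "fst b = g0 \<or> fst a \<noteq> g0" for a b
  proof -
    have "\<exists>r. shortest_path (G \<box> H) (fst a, snd a) r (fst b, snd b) \<and>
        {fst a} \<times> set (k (snd a) (snd b)) \<subseteq> set r"
      using ex_shortest_path_through_layer[OF G _ _ kS(1)[OF snd[OF ab(1)] snd[OF ab(2)]],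
          of "fst a" "fst b"] ab T by auto
    then show ?thesis using ab or unfolding P_def by auto
  qed
  have "\<exists>f. \<forall>a\<in>?T. \<forall>b\<in>?T. P a b (f a b) \<and> f b a = rev (f a b)"
  proof (rule symmetric_path_choice[OF finT])
    fix a b assume ab: "a \<in> ?T" "b \<in> ?T"
    show "\<exists>r. P a b r"
    proof (cases "fst b = g0 \<or> fst a \<noteq> g0")
      case False
      then obtain r where "P b a r" using P_ex[OF ab(2,1)] by blast
      then show ?thesis using P_rev by blast
    qed (rule P_ex[OF ab])
  next
    show "rev r = r" if "P a a r" for a r
      using that shortest_path_self[of "G \<box> H" a r] by (simp add: P_def)
  qed (rule P_rev)
  then obtain f where f: "\<And>a b. a \<in> ?T \<Longrightarrow> b \<in> ?T \<Longrightarrow> P a b (f a b) \<and> f b a = rev (f a b)"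
    by blast
  have path: "path_between (G \<box> H) a (f a b) b" if "a \<in> ?T" "b \<in> ?T" for a b
    using conjunct1[OF f[OF that]] by (simp add: P_def shortest_path_def)
  show ?thesis
  proof (cases "\<exists>a. ?T = {a}")
    case True
    then obtain g s where T1: "?T = {(g, s)}" by auto
    obtain x where x: "x \<in> X" using \<open>X \<noteq> {}\<close> by auto
    \<comment> \<open>A singleton has no pair of distinct vertices, so the one-vertex convention
      must apply. Both factors are therefore shown to be trivial, H because
      \<open>k s s = [s]\<close> already covers it.\<close>
    have eq: "v = g \<and> t = s" if "(v, t) \<in> ?T" for v t
      using that unfolding T1 by simp
    have "t = s" if "t \<in> S" for t using eq[of g0 t] that by simp
    then have Ss: "S = {s}" "X = {s}" using X x by auto
    have "v = g" if "v \<in> pverts G" for v using eq[of v x] that x X by auto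
    then have "pverts G = {g}" using g0 by auto
    moreover have "pverts H = {s}"
      using cover Ss shortest_path_self[OF kS(1), of s] by simp
    ultimately have "pverts (G \<box> H) = {(g, s)}" by auto
    then show ?thesis using T1 by (simp add: strong_geodetic_set_def)
  next
    case False
    have "(\<Union>(a, b) \<in> {(a, b). a \<in> ?T \<and> b \<in> ?T \<and> a \<noteq> b}. set (f a b)) = pverts (G \<box> H)"
      (is "?U = _")
    proof (intro equalityI subsetI)
      fix w assume "w \<in> pverts (G \<box> H)"
      then obtain g v where w: "w = (g, v)" "g \<in> pverts G" "v \<in> pverts H" by auto
      then obtain u s where us: "u \<in> X" "s \<in> S" "v \<in> set (k u s)" using cover by blast
      have a: "(g, u) \<in> ?T" using us w X by auto
      show "w \<in> ?U"
      \<comment> \<open>If u = s, the core path is \<open>[u]\<close> and w is itself a member of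
        the set, covered by a path to any other member.\<close>
      proof (cases "u = s")
        case True
        then have "w = (g, u)" using us w shortest_path_self[OF kS(1), of s] by auto
        moreover obtain b where "b \<in> ?T" "b \<noteq> (g, u)" using False a by blast
        ultimately show ?thesis using a path_between_start_in_set[OF path[OF a, of b]] by blast
      next
        case False
        \<comment> \<open>If \<open>(g, s)\<close> is missing then g differs from \<open>g0\<close>,
          and \<open>(g0, s)\<close> takes its place. In both cases P with c = g puts the layer copy
          of \<open>k u s\<close> on the path.\<close>
        define b where "b = (if (g, s) \<in> ?T then (g, s) else (g0, s))"
        have b: "b \<in> ?T" "b \<noteq> (g, u)" using us False by (auto simp: b_def)
        have "(g, v) \<in> set (f (g, u) b)"
          using conjunct1[OF f[OF a b(1)]] us by (auto simp: P_def b_def split: if_splits)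
        then show ?thesis using w a b by blast
      qed
    next
      fix w assume "w \<in> ?U"
      then obtain a b where ab: "a \<in> ?T" "b \<in> ?T" and w: "w \<in> set (f a b)" by blast
      show "w \<in> pverts (G \<box> H)" using path[OF ab] w unfolding path_between_iff by blast
    qed
    moreover have "fixed_shortest_paths (G \<box> H) ?T f"
      using f unfolding fixed_shortest_paths_def P_def by blast
    ultimately show ?thesis using T unfolding strong_geodetic_set_def by blast
  qed
qed

text \<open>Layer \<open>g0\<close> contributes \<open>sg H\<close> vertices, and each of the
  remaining layers contributes \<open>sgc H\<close>.\<close>

lemma ex_strong_geodetic_set_cartesian_product:
  assumes G: "pair_graph G" "Digraph_Component.connected (with_proj G)"
    and H: "pair_graph H" "Digraph_Component.connected (with_proj H)"
  obtains T where "strong_geodetic_set (G \<box> H) T" "card T \<le> sgc H * (order G - 1) + sg H"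
proof -
  interpret G: pair_graph G by fact
  interpret H: pair_graph H by fact
  obtain S X where SX: "sg_set H S" "strong_geodetic_core H S X" "card X = sgc H"
    using ex_minimum_core[OF H] .
  obtain g0 where g0: "g0 \<in> pverts G"
    using connected_pverts_nonempty[OF G(2)] by blast
  have S: "S \<subseteq> pverts H" "card S = sg H"
    using SX by (auto simp: sg_set_def strong_geodetic_set_def)
  have fin: "finite S" "finite X"
    using S SX H.pair_finite_verts finite_subset[of S] finite_subset[of X S]
    by (auto simp: strong_geodetic_core_def)
  have "strong_geodetic_set (G \<box> H) ({g0} \<times> S \<union> (pverts G - {g0}) \<times> X)"
    using strong_geodetic_set_cartesian_product[OF G H(1) connected_pverts_nonempty[OF H(2)] S(1) SX(2) g0] .
  moreover have "card ({g0} \<times> S \<union> (pverts G - {g0}) \<times> X) \<le> sgc H * (order G - 1) + sg H"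
  proof -
    have "card ({g0} \<times> S \<union> (pverts G - {g0}) \<times> X) \<le> card ({g0} \<times> S) + card ((pverts G - {g0}) \<times> X)"
      by (rule card_Un_le)
    also have "\<dots> = sgc H * (order G - 1) + sg H"
      using fin G.pair_finite_verts g0 S SX(3) by (simp add: card_cartesian_product order_def)
    finally show ?thesis .
  qed
  ultimately show ?thesis by (rule that)
qed

section \<open>Swapping the factors\<close>

lemma path_between_swap:
  assumes "path_between (G \<box> H) a p b"
  shows "path_between (H \<box> G) (prod.swap a) (map prod.swap p) (prod.swap b)"
  using assms
  by (fastforce simp: path_between_iff hd_map last_map vwalk_arcs_map distinct_map)

text \<open>Competitors are swapped back to \<open>G \<box> H\<close>, where minimality is known;
  swapping keeps lengths.\<close>

lemma shortest_path_swap: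
  assumes "shortest_path (G \<box> H) a p b"
  shows "shortest_path (H \<box> G) (prod.swap a) (map prod.swap p) (prod.swap b)"
  using assms path_between_swap[of G H a p b] path_between_swap[of H G "prod.swap a" _ "prod.swap b"]
  unfolding shortest_path_def by fastforce

lemma strong_geodetic_set_swap:
  assumes "strong_geodetic_set (G \<box> H) T"
  shows "strong_geodetic_set (H \<box> G) (prod.swap ` T)"
  using assms unfolding strong_geodetic_set_def[of "G \<box> H"]
proof (elim conjE disjE exE)
  fix f assume T: "T \<subseteq> pverts (G \<box> H)" and f: "fixed_shortest_paths (G \<box> H) T f"
    and cover: "(\<Union>(x, y) \<in> {(x, y). x \<in> T \<and> y \<in> T \<and> x \<noteq> y}. set (f x y)) = pverts (G \<box> H)"
  define f' where "f' a b = map prod.swap (f (prod.swap a) (prod.swap b))" for a b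
  have "fixed_shortest_paths (H \<box> G) (prod.swap ` T) f'"
    unfolding fixed_shortest_paths_def
  proof (intro ballI conjI)
    fix a b assume "a \<in> prod.swap ` T" "b \<in> prod.swap ` T"
    then have ab: "prod.swap a \<in> T" "prod.swap b \<in> T" by auto
    show "shortest_path (H \<box> G) a (f' a b) b"
      using shortest_path_swap[OF fixed_shortest_pathsD(1)[OF f ab]] by (simp add: f'_def)
    show "f' b a = rev (f' a b)"
      using fixed_shortest_pathsD(3)[OF f ab] by (simp add: f'_def rev_map)
  qed
  note f' = this
  have "(\<Union>(x, y) \<in> {(x, y). x \<in> prod.swap ` T \<and> y \<in> prod.swap ` T \<and> x \<noteq> y}. set (f' x y))
      = pverts (H \<box> G)" (is "?U = _")
  proof (intro equalityI subsetI)
    fix w assume "w \<in> ?U"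
    then obtain x y where "x \<in> prod.swap ` T" "y \<in> prod.swap ` T" and w: "w \<in> set (f' x y)" by blast
    then have "path_between (H \<box> G) x (f' x y) y" using fixed_shortest_pathsD(2)[OF f'] by blast
    then show "w \<in> pverts (H \<box> G)" using w unfolding path_between_iff by blast
  next
    fix w assume "w \<in> pverts (H \<box> G)"
    then have "prod.swap w \<in> pverts (G \<box> H)" by auto
    then obtain x y where xy: "x \<in> T" "y \<in> T" "x \<noteq> y" and w: "prod.swap w \<in> set (f x y)"
      using cover by blast
    have "w \<in> set (f' (prod.swap x) (prod.swap y))"
      using imageI[OF w, of prod.swap] by (simp add: f'_def)
    moreover have "prod.swap x \<noteq> prod.swap y" using xy(3) by (auto simp: prod_eq_iff)
    ultimately show "w \<in> ?U" using xy(1,2) by blast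
  qed
  moreover have "prod.swap ` T \<subseteq> pverts (H \<box> G)" using T by auto
  ultimately show ?thesis using f' unfolding strong_geodetic_set_def by blast
next
  fix v assume "pverts (G \<box> H) = {v}" "T = {v}"
  moreover have "pverts (H \<box> G) = prod.swap ` pverts (G \<box> H)" by (simp add: product_swap)
  ultimately show ?thesis by (simp add: strong_geodetic_set_def)
qed

theorem theorem5p1:
  fixes G :: "'a pair_pre_digraph" and H :: "'b pair_pre_digraph"
  assumes "pair_graph G" and "pair_graph H"
    and "Digraph_Component.connected (with_proj G)"
    and "Digraph_Component.connected (with_proj H)"
  shows "sg (G \<box> H) \<le>
    min (sgc H * (order G - 1) + sg H) (sgc G * (order H - 1) + sg G)"
proof -
  obtain T where T: "strong_geodetic_set (G \<box> H) T" "card T \<le> sgc H * (order G - 1) + sg H"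
    using ex_strong_geodetic_set_cartesian_product[OF assms(1,3,2,4)] .
  obtain U where U: "strong_geodetic_set (H \<box> G) U" "card U \<le> sgc G * (order H - 1) + sg G"
    using ex_strong_geodetic_set_cartesian_product[OF assms(2,4,1,3)] .
  \<comment> \<open>The second bound was built in \<open>H \<box> G\<close>; the swap carries its
    set over injectively, without changing the cardinality.\<close>
  have "sg (G \<box> H) \<le> card (prod.swap ` U)"
    using U(1) by (intro sg_le_card strong_geodetic_set_swap)
  also have "\<dots> = card U" by (rule card_image) simp
  finally show ?thesis using T U sg_le_card[OF T(1)] by linarith
qed

end
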